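(* Let $M$ be a group, with group operation written $xy$, and let $\cdot$ be a binary operation on the set $M$. Then the map $s:M\times M\to M\times M$, $s(x,y)=(x\cdot y,\ xy)$, is a solution on $M$ if and only if $M$ is an elementary abelian $2$-group and $x\cdot y=x$ holds for all $x,y\in M$.
   Context: A solution (set-theoretical solution of the pentagon equation) on a set $M$ is a map $s:M\times M\to M\times M$ such that $s_{23}\,s_{13}\,s_{12}=s_{12}\,s_{23}$ as maps $M\times M\times M\to M\times M\times M$ (composition of maps, rightmost applied first), where $s_{12}=s\times \mathrm{id}_M$, $s_{23}=\mathrm{id}_M\times s$, $s_{13}=(\mathrm{id}_M\times\tau)\,s_{12}\,(\mathrm{id}_M\times\tau)$, and $\tau(x,y)=(y,x)$ is the flip map on $M\times M$. The operation $\cdot$ is not assumed to be related to the group operation of $M$. An elementary abelian $2$-group is an abelian group in which $x^2=1$ for every element $x$ (the trivial group is allowed, and the group need not be finite). *)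

theory Defs
  imports "HOL-Algebra.Group"
begin

text \<open>
  The triple product is right-nested, \<open>M \<times> M \<times> M = M \<times> (M \<times> M)\<close>, so \<open>s \<times> id\<close> has to be
  conjugated by reassociation.
\<close>

definition leg12 :: "('a \<times> 'a \<Rightarrow> 'a \<times> 'a) \<Rightarrow> 'a \<times> 'a \<times> 'a \<Rightarrow> 'a \<times> 'a \<times> 'a" where
  "leg12 s = (\<lambda>((x, y), z). (x, y, z)) \<circ> map_prod s id \<circ> (\<lambda>(x, y, z). ((x, y), z))"

definition leg23 :: "('a \<times> 'a \<Rightarrow> 'a \<times> 'a) \<Rightarrow> 'a \<times> 'a \<times> 'a \<Rightarrow> 'a \<times> 'a \<times> 'a" where
  "leg23 s = map_prod id s"

definition leg13 :: "('a \<times> 'a \<Rightarrow> 'a \<times> 'a) \<Rightarrow> 'a \<times> 'a \<times> 'a \<Rightarrow> 'a \<times> 'a \<times> 'a" where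
  "leg13 s = map_prod id prod.swap \<circ> leg12 s \<circ> map_prod id prod.swap"

text \<open>Values of \<open>s\<close> outside \<open>M \<times> M\<close> are irrelevant.\<close>

definition pentagon_solution :: "'a set \<Rightarrow> ('a \<times> 'a \<Rightarrow> 'a \<times> 'a) \<Rightarrow> bool" where
  "pentagon_solution M s \<longleftrightarrow>
     s \<in> M \<times> M \<rightarrow> M \<times> M \<and>
     (\<forall>t \<in> M \<times> M \<times> M. (leg23 s \<circ> leg13 s \<circ> leg12 s) t = (leg12 s \<circ> leg23 s) t)"

definition elementary_abelian_2_group :: "('a, 'b) monoid_scheme \<Rightarrow> bool" where
  "elementary_abelian_2_group G \<longleftrightarrow>
     comm_group G \<and> (\<forall>x \<in> carrier G. x [^]\<^bsub>G\<^esub> (2::nat) = \<one>\<^bsub>G\<^esub>)"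

end

theory Submission
  imports Defs
begin

text \<open>
  Evaluated at \<open>(x, y, z)\<close>, the pentagon equation for \<open>s (x, y) = (x \<cdot> y, xy)\<close> becomes three
  equations, one for each component. The third, \<open>xy(x \<cdot> y)z = yz\<close>, can be solved in the group:
  it forces \<open>x \<cdot> y = y\<inverse> x\<inverse> y\<close>. So the operation is determined, and \<open>x \<cdot> 1 = x\<inverse>\<close>. The first
  equation says that the operation is associative; at \<open>y = z = 1\<close> it reads \<open>(x\<inverse>)\<inverse> = x\<inverse>\<close>, so that
  every element is its own inverse. A group with this property is abelian, and then
  \<open>y\<inverse> x\<inverse> y = x\<inverse> = x\<close>. Conversely, for the first projection on an elementary abelian
  2-group only the third equation is not immediate, and it reads \<open>xyxz = yz\<close>.
\<close>

lemma pentagon_solution_iff_components: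
  assumes "\<And>x y. x \<in> A \<Longrightarrow> y \<in> A \<Longrightarrow> d x y \<in> A"
    and "\<And>x y. x \<in> A \<Longrightarrow> y \<in> A \<Longrightarrow> m x y \<in> A"
  shows "pentagon_solution A (\<lambda>(x, y). (d x y, m x y)) \<longleftrightarrow>
    (\<forall>x \<in> A. \<forall>y \<in> A. \<forall>z \<in> A.
      d (d x y) z = d x (d y z) \<and>
      d (m x y) (m (d x y) z) = m x (d y z) \<and>
      m (m x y) (m (d x y) z) = m y z)"
  using assms
  by (auto simp: pentagon_solution_def leg12_def leg13_def leg23_def)

lemma (in group) elementary_abelian_2_groupI:
  assumes involutive: "\<And>x. x \<in> carrier G \<Longrightarrow> inv x = x"
  shows "elementary_abelian_2_group G"
  unfolding elementary_abelian_2_group_def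
proof (intro conjI ballI)
  show "comm_group G"
  proof (rule group_comm_groupI)
    fix x y assume "x \<in> carrier G" "y \<in> carrier G"
    then show "x \<otimes> y = y \<otimes> x"
      by (metis inv_mult_group involutive m_closed)
  qed
  show "x [^] (2::nat) = \<one>" if "x \<in> carrier G" for x
    using that r_inv[of x] by (simp add: involutive numeral_2_eq_2)
qed

lemma elementary_abelian_2_group_square:
  fixes G (structure)
  assumes "elementary_abelian_2_group G" and "x \<in> carrier G"
  shows "x \<otimes> x = \<one>"
proof -
  interpret comm_group G
    using assms(1) by (simp add: elementary_abelian_2_group_def)
  show ?thesis
    using assms by (simp add: elementary_abelian_2_group_def numeral_2_eq_2)
qed

theorem proposition17:
  fixes M :: "('a, 'b) monoid_scheme" (structure)
    and dot :: "'a \<Rightarrow> 'a \<Rightarrow> 'a"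
  assumes "group M"
    and "dot \<in> carrier M \<rightarrow> carrier M \<rightarrow> carrier M"
  shows "pentagon_solution (carrier M) (\<lambda>(x, y). (dot x y, x \<otimes> y)) \<longleftrightarrow>
    elementary_abelian_2_group M \<and> (\<forall>x \<in> carrier M. \<forall>y \<in> carrier M. dot x y = x)"
    (is "?pentagon \<longleftrightarrow> ?elementary \<and> ?projection")
proof -
  interpret group M by fact
  have dot_closed: "dot x y \<in> carrier M" if "x \<in> carrier M" "y \<in> carrier M" for x y
    using assms(2) that by auto
  note components =
    pentagon_solution_iff_components[of "carrier M" dot "(\<otimes>)", OF dot_closed m_closed]
  show ?thesis
  proof
    assume "?pentagon"
    then have assoc: "dot (dot x y) z = dot x (dot y z)"
      and third: "(x \<otimes> y) \<otimes> (dot x y \<otimes> z) = y \<otimes> z"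
      if "x \<in> carrier M" "y \<in> carrier M" "z \<in> carrier M" for x y z
      using that by (simp_all add: components)
    have dot_eq: "dot x y = inv (x \<otimes> y) \<otimes> y" if "x \<in> carrier M" "y \<in> carrier M" for x y
      using third[of x y \<one>] that dot_closed[of x y] by (simp add: inv_solve_left)
    have involutive: "inv x = x" if "x \<in> carrier M" for x
      using assoc[of x \<one> \<one>] that by (simp add: dot_eq)
    then have elementary: "?elementary"
      by (rule elementary_abelian_2_groupI)
    then interpret comm_group M
      by (simp add: elementary_abelian_2_group_def)
    have "dot x y = x" if "x \<in> carrier M" "y \<in> carrier M" for x y
    proof -
      have "dot x y = (x \<otimes> y) \<otimes> y"
        using that by (simp add: dot_eq involutive)
      also have "\<dots> = x"
        using that elementary by (simp add: m_assoc elementary_abelian_2_group_square)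
      finally show ?thesis .
    qed
    with elementary show "?elementary \<and> ?projection" by blast
  next
    assume asm: "?elementary \<and> ?projection"
    then interpret comm_group M
      by (simp add: elementary_abelian_2_group_def)
    have "(x \<otimes> y) \<otimes> (x \<otimes> z) = y \<otimes> z"
      if "x \<in> carrier M" "y \<in> carrier M" "z \<in> carrier M" for x y z
    proof -
      have "(x \<otimes> y) \<otimes> (x \<otimes> z) = (x \<otimes> x) \<otimes> (y \<otimes> z)"
        using that by (simp add: m_ac)
      also have "\<dots> = y \<otimes> z"
        using that asm by (simp add: elementary_abelian_2_group_square)
      finally show ?thesis .
    qed
    with asm show "?pentagon"
      by (simp add: components)
  qed
qed

end
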